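(* ApprxAlgoWithColouring is a polynomial-time approximation algorithm for DDP: it outputs a partition of the deliveries into feasible assignments using at most $2\,\mathrm{OPT}+\omega$ drones, where $\mathrm{OPT}$ is the optimum number of drones for the instance and $\omega$ is the maximum clique size of the interval graph $G$ of the delivery time intervals.
   Context: DDP instance: deliveries $j=1,\dots,n$, each with a closed delivery time interval $I_j=[t_j^L,t_j^R]$ and cost $0<c_j\le B$, where $B>0$ is the battery budget of identical drones. A set of intervals is feasible if the intervals are pairwise disjoint and their total cost is at most $B$. DDP asks for the minimum number $\mathrm{OPT}$ of drones such that the deliveries can be partitioned into that many feasible sets. The interval graph $G$ has one vertex per interval and an edge iff the intervals intersect. ApprxAlgoWithColouring: properly colour $G$ with $\omega$ colours; let $J_k$ be the intervals of colour $k$; for each $k$ run GreedyAlgoModified on $J_k$, which processes the intervals of $J_k$ one by one, assigning the current interval $I_j$ to an opened drone of maximum remaining capacity if that capacity is at least $c_j$, and otherwise opening a new drone for it; output the union of all drones and assignments over $k=1,\dots,\omega$. *)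

theory Defs
  imports
    Complex_Main
    "HOL-Library.Disjoint_Sets"
    "HOL-Library.Ramsey"
    "HOL-Library.Time_Functions"
    "HOL-Computational_Algebra.Polynomial"
begin

section \<open>The drone delivery problem\<close>

datatype delivery = Delivery (tL: real) (tR: real) (cost: real)

text \<open>An instance is a budget \<open>B\<close> and a list \<open>ds\<close>; its deliveries are named by their
  positions in \<open>ds\<close>, so that different deliveries may have equal intervals and costs.\<close>

definition ddp_instance :: "real \<Rightarrow> delivery list \<Rightarrow> bool" where
  "ddp_instance B ds \<longleftrightarrow>
     0 < B \<and> (\<forall>d \<in> set ds. tL d \<le> tR d \<and> 0 < cost d \<and> cost d \<le> B)"

definition deliveries :: "delivery list \<Rightarrow> nat set" where
  "deliveries ds = {..<length ds}"

definition ivl :: "delivery list \<Rightarrow> nat \<Rightarrow> real set" where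
  "ivl ds j = {tL (ds ! j) .. tR (ds ! j)}"

definition feasible :: "real \<Rightarrow> delivery list \<Rightarrow> nat set \<Rightarrow> bool" where
  "feasible B ds S \<longleftrightarrow> disjoint_family_on (ivl ds) S \<and> (\<Sum>j\<in>S. cost (ds ! j)) \<le> B"

definition OPT :: "real \<Rightarrow> delivery list \<Rightarrow> nat" where
  "OPT B ds = (LEAST m. \<exists>P. partition_on (deliveries ds) P \<and> (\<forall>S\<in>P. feasible B ds S) \<and> card P = m)"

text \<open>A drone is the list of the deliveries assigned to it, and an output is a list of drones.\<close>

definition ddp_solution :: "real \<Rightarrow> delivery list \<Rightarrow> nat list list \<Rightarrow> bool" where
  "ddp_solution B ds out \<longleftrightarrow>
     distinct (concat out) \<and> partition_on (deliveries ds) (set ` set out) \<and>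
     (\<forall>D \<in> set out. feasible B ds (set D))"


section \<open>The interval graph\<close>

definition interval_graph :: "delivery list \<Rightarrow> nat set set" where
  "interval_graph ds =
     {{i, j} | i j. i \<in> deliveries ds \<and> j \<in> deliveries ds \<and> i \<noteq> j \<and> ivl ds i \<inter> ivl ds j \<noteq> {}}"

definition clique_number :: "delivery list \<Rightarrow> nat" where
  "clique_number ds = Max {card K | K. K \<subseteq> deliveries ds \<and> clique K (interval_graph ds)}"

definition proper_colouring :: "delivery list \<Rightarrow> nat \<Rightarrow> (nat \<Rightarrow> nat) \<Rightarrow> bool" where
  "proper_colouring ds q \<kappa> \<longleftrightarrow>
     \<kappa> ` deliveries ds \<subseteq> {1..q} \<and> (\<forall>i j. {i, j} \<in> interval_graph ds \<longrightarrow> \<kappa> i \<noteq> \<kappa> j)"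


section \<open>The algorithm\<close>

text \<open>The algorithm leaves open which colouring is used, in which order the deliveries of one
  colour are processed, and how ties between drones of maximum remaining capacity are broken.
  It is therefore described by relations that admit every such choice.\<close>

definition remaining :: "real \<Rightarrow> delivery list \<Rightarrow> nat list \<Rightarrow> real" where
  "remaining B ds D = B - (\<Sum>j\<leftarrow>D. cost (ds ! j))"

inductive greedy_step ::
  "real \<Rightarrow> delivery list \<Rightarrow> nat \<Rightarrow> nat list list \<Rightarrow> nat list list \<Rightarrow> bool"
  for B :: real and ds :: "delivery list" and j :: nat and Ds :: "nat list list" where
  assign: "\<lbrakk>i < length Ds; \<forall>D \<in> set Ds. remaining B ds D \<le> remaining B ds (Ds ! i);
            cost (ds ! j) \<le> remaining B ds (Ds ! i)\<rbrakk>
           \<Longrightarrow> greedy_step B ds j Ds (Ds[i := j # Ds ! i])"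
| open_new: "\<forall>D \<in> set Ds. remaining B ds D < cost (ds ! j)
           \<Longrightarrow> greedy_step B ds j Ds (Ds @ [[j]])"

inductive greedy_run ::
  "real \<Rightarrow> delivery list \<Rightarrow> nat list \<Rightarrow> nat list list \<Rightarrow> nat list list \<Rightarrow> bool"
  for B :: real and ds :: "delivery list" where
  Nil: "greedy_run B ds [] Ds Ds"
| Cons: "greedy_step B ds j Ds Ds' \<Longrightarrow> greedy_run B ds js Ds' Ds'' \<Longrightarrow>
         greedy_run B ds (j # js) Ds Ds''"

definition GreedyAlgoModified ::
  "real \<Rightarrow> delivery list \<Rightarrow> nat set \<Rightarrow> nat list list \<Rightarrow> bool" where
  "GreedyAlgoModified B ds J Ds \<longleftrightarrow>
     (\<exists>js. distinct js \<and> set js = J \<and> greedy_run B ds js [] Ds)"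

definition ApprxAlgoWithColouring ::
  "real \<Rightarrow> delivery list \<Rightarrow> nat list list \<Rightarrow> bool" where
  "ApprxAlgoWithColouring B ds out \<longleftrightarrow>
     (\<exists>\<kappa> outs. proper_colouring ds (clique_number ds) \<kappa> \<and>
        (\<forall>k \<in> {1..clique_number ds}.
            GreedyAlgoModified B ds {j \<in> deliveries ds. \<kappa> j = k} (outs k)) \<and>
        out = concat (map outs [1..<Suc (clique_number ds)]))"


section \<open>An implementation and its running time\<close>

text \<open>The colouring is first-fit in the order of left endpoints. This needs at most as many
  colours as the largest clique has vertices, so the clique number is not computed.\<close>

fun index_from :: "nat \<Rightarrow> delivery list \<Rightarrow> nat list" where
  "index_from i [] = []"
| "index_from i (d # ds) = i # index_from (Suc i) ds"

fun insort_left :: "delivery list \<Rightarrow> nat \<Rightarrow> nat list \<Rightarrow> nat list" where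
  "insort_left ds j [] = [j]"
| "insort_left ds j (k # ks) =
     (if tL (ds ! j) \<le> tL (ds ! k) then j # k # ks else k # insort_left ds j ks)"

fun isort_left :: "delivery list \<Rightarrow> nat list \<Rightarrow> nat list" where
  "isort_left ds [] = []"
| "isort_left ds (j # js) = insort_left ds j (isort_left ds js)"

fun conflict :: "delivery list \<Rightarrow> nat \<Rightarrow> nat list \<Rightarrow> bool" where
  "conflict ds j [] = False"
| "conflict ds j (k # ks) =
     (if tL (ds ! j) \<le> tR (ds ! k) \<and> tL (ds ! k) \<le> tR (ds ! j) then True else conflict ds j ks)"

fun first_fit :: "delivery list \<Rightarrow> nat \<Rightarrow> nat list list \<Rightarrow> nat list list" where
  "first_fit ds j [] = [[j]]"
| "first_fit ds j (C # Cs) =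
     (if conflict ds j C then C # first_fit ds j Cs else (j # C) # Cs)"

fun colour_classes :: "delivery list \<Rightarrow> nat list \<Rightarrow> nat list list \<Rightarrow> nat list list" where
  "colour_classes ds [] Cs = Cs"
| "colour_classes ds (j # js) Cs = colour_classes ds js (first_fit ds j Cs)"

fun rem_cap :: "real \<Rightarrow> delivery list \<Rightarrow> nat list \<Rightarrow> real" where
  "rem_cap B ds [] = B"
| "rem_cap B ds (j # D) = rem_cap B ds D - cost (ds ! j)"

fun max_cap :: "real \<Rightarrow> delivery list \<Rightarrow> real \<Rightarrow> nat list list \<Rightarrow> real" where
  "max_cap B ds m [] = m"
| "max_cap B ds m (D # Ds) = max_cap B ds (max m (rem_cap B ds D)) Ds"

fun place :: "real \<Rightarrow> delivery list \<Rightarrow> nat \<Rightarrow> real \<Rightarrow> nat list list \<Rightarrow> nat list list" where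
  "place B ds j m [] = []"
| "place B ds j m (D # Ds) =
     (if m \<le> rem_cap B ds D then (j # D) # Ds else D # place B ds j m Ds)"

text \<open>Costs are positive and remaining capacities are nonnegative, so starting the maximum
  at \<open>0\<close> is harmless and makes the case without opened drones open a new one.\<close>

fun assign_delivery :: "real \<Rightarrow> delivery list \<Rightarrow> nat \<Rightarrow> nat list list \<Rightarrow> nat list list" where
  "assign_delivery B ds j Ds =
     (let m = max_cap B ds 0 Ds
      in if cost (ds ! j) \<le> m then place B ds j m Ds else Ds @ [[j]])"

fun greedy :: "real \<Rightarrow> delivery list \<Rightarrow> nat list \<Rightarrow> nat list list \<Rightarrow> nat list list" where
  "greedy B ds [] Ds = Ds"
| "greedy B ds (j # js) Ds = greedy B ds js (assign_delivery B ds j Ds)"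

fun greedy_classes :: "real \<Rightarrow> delivery list \<Rightarrow> nat list list \<Rightarrow> nat list list" where
  "greedy_classes B ds [] = []"
| "greedy_classes B ds (C # Cs) = greedy B ds C [] @ greedy_classes B ds Cs"

fun apprx_algo :: "real \<Rightarrow> delivery list \<Rightarrow> nat list list" where
  "apprx_algo B ds =
     greedy_classes B ds (colour_classes ds (isort_left ds (index_from 0 ds)) [])"

text \<open>Step counts, obtained from the equations above by the translation of
  \<^theory>\<open>HOL-Library.Time_Commands\<close>: evaluation is call-by-value, every call of a recursive
  function costs one step plus the steps of the calls it makes, and a call makes only boundedly
  many constructor, selector, comparison, maximum and subtraction operations of its own, which
  are not charged separately. List access \<open>(!)\<close> and append are charged in full. The numbers
  that occur are input numbers and differences of \<open>B\<close> and sums of input costs.\<close>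

fun T_index_from :: "nat \<Rightarrow> delivery list \<Rightarrow> nat" where
  "T_index_from i [] = 1"
| "T_index_from i (d # ds) = T_index_from (Suc i) ds + 1"

fun T_insort_left :: "delivery list \<Rightarrow> nat \<Rightarrow> nat list \<Rightarrow> nat" where
  "T_insort_left ds j [] = 1"
| "T_insort_left ds j (k # ks) =
     T_nth ds j + T_nth ds k +
     (if tL (ds ! j) \<le> tL (ds ! k) then 0 else T_insort_left ds j ks) + 1"

fun T_isort_left :: "delivery list \<Rightarrow> nat list \<Rightarrow> nat" where
  "T_isort_left ds [] = 1"
| "T_isort_left ds (j # js) =
     T_isort_left ds js + T_insort_left ds j (isort_left ds js) + 1"

fun T_conflict :: "delivery list \<Rightarrow> nat \<Rightarrow> nat list \<Rightarrow> nat" where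
  "T_conflict ds j [] = 1"
| "T_conflict ds j (k # ks) =
     T_nth ds j + T_nth ds k + (T_nth ds k + T_nth ds j) +
     (if tL (ds ! j) \<le> tR (ds ! k) \<and> tL (ds ! k) \<le> tR (ds ! j) then 0
      else T_conflict ds j ks) + 1"

fun T_first_fit :: "delivery list \<Rightarrow> nat \<Rightarrow> nat list list \<Rightarrow> nat" where
  "T_first_fit ds j [] = 1"
| "T_first_fit ds j (C # Cs) =
     T_conflict ds j C + (if conflict ds j C then T_first_fit ds j Cs else 0) + 1"

fun T_colour_classes :: "delivery list \<Rightarrow> nat list \<Rightarrow> nat list list \<Rightarrow> nat" where
  "T_colour_classes ds [] Cs = 1"
| "T_colour_classes ds (j # js) Cs =
     T_first_fit ds j Cs + T_colour_classes ds js (first_fit ds j Cs) + 1"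

fun T_rem_cap :: "real \<Rightarrow> delivery list \<Rightarrow> nat list \<Rightarrow> nat" where
  "T_rem_cap B ds [] = 1"
| "T_rem_cap B ds (j # D) = T_rem_cap B ds D + T_nth ds j + 1"

fun T_max_cap :: "real \<Rightarrow> delivery list \<Rightarrow> real \<Rightarrow> nat list list \<Rightarrow> nat" where
  "T_max_cap B ds m [] = 1"
| "T_max_cap B ds m (D # Ds) =
     T_rem_cap B ds D + T_max_cap B ds (max m (rem_cap B ds D)) Ds + 1"

fun T_place :: "real \<Rightarrow> delivery list \<Rightarrow> nat \<Rightarrow> real \<Rightarrow> nat list list \<Rightarrow> nat" where
  "T_place B ds j m [] = 1"
| "T_place B ds j m (D # Ds) =
     T_rem_cap B ds D + (if m \<le> rem_cap B ds D then 0 else T_place B ds j m Ds) + 1"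

fun T_assign_delivery :: "real \<Rightarrow> delivery list \<Rightarrow> nat \<Rightarrow> nat list list \<Rightarrow> nat" where
  "T_assign_delivery B ds j Ds =
     T_max_cap B ds 0 Ds +
     (let m = max_cap B ds 0 Ds
      in T_nth ds j +
         (if cost (ds ! j) \<le> m then T_place B ds j m Ds else T_append Ds [[j]]))"

fun T_greedy :: "real \<Rightarrow> delivery list \<Rightarrow> nat list \<Rightarrow> nat list list \<Rightarrow> nat" where
  "T_greedy B ds [] Ds = 1"
| "T_greedy B ds (j # js) Ds =
     T_assign_delivery B ds j Ds + T_greedy B ds js (assign_delivery B ds j Ds) + 1"

fun T_greedy_classes :: "real \<Rightarrow> delivery list \<Rightarrow> nat list list \<Rightarrow> nat" where
  "T_greedy_classes B ds [] = 1"
| "T_greedy_classes B ds (C # Cs) =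
     T_greedy B ds C [] + T_greedy_classes B ds Cs +
     T_append (greedy B ds C []) (greedy_classes B ds Cs) + 1"

fun T_apprx_algo :: "real \<Rightarrow> delivery list \<Rightarrow> nat" where
  "T_apprx_algo B ds =
     T_index_from 0 ds + T_isort_left ds (index_from 0 ds) +
     T_colour_classes ds (isort_left ds (index_from 0 ds)) [] +
     T_greedy_classes B ds (colour_classes ds (isort_left ds (index_from 0 ds)) [])"

end

theory Submission
  imports Defs
begin

text \<open>Within one colour class at most one drone has load at most \<open>B / 2\<close>, so \<open>m\<close> drones carry a
  total cost of at least \<open>(m - 1) * B / 2\<close>. Summing over the \<open>\<omega>\<close> classes and bounding the total
  cost of all deliveries by \<open>B * OPT\<close> gives \<open>2 * OPT + \<omega>\<close>. First-fit in the order of left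
  endpoints opens a new class only at a point covered by an interval from every class, so it uses
  at most \<open>\<omega>\<close> colours.\<close>

section \<open>The greedy algorithm\<close>

text \<open>The counterpart of \<open>remaining\<close>: \<open>remaining B ds D\<close> is
  \<open>B - load ds D\<close>. Loads are additive under append, which suits the counting
  below.\<close>

definition load :: "delivery list \<Rightarrow> nat list \<Rightarrow> real" where
  "load ds D = (\<Sum>j\<leftarrow>D. cost (ds ! j))"

lemma load_simps [simp]:
  "load ds [] = 0"
  "load ds (j # D) = cost (ds ! j) + load ds D"
  "load ds (D @ D') = load ds D + load ds D'"
  by (simp_all add: load_def)

lemma load_nonneg: "(\<And>j. j \<in> set D \<Longrightarrow> 0 \<le> cost (ds ! j)) \<Longrightarrow> 0 \<le> load ds D"
  by (induction D) (auto intro!: add_nonneg_nonneg)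

lemma load_eq_sum: "distinct D \<Longrightarrow> load ds D = (\<Sum>j\<in>set D. cost (ds ! j))"
  by (simp add: load_def sum_list_distinct_conv_sum_set)

text \<open>Trades the index update for a split of the list at the chosen drone, and capacities for
  loads. Facts about \<open>set\<close>, \<open>filter\<close> and \<open>concat\<close> then follow
  by simplification.\<close>

lemma greedy_stepE:
  assumes "greedy_step B ds j Ds Ds'"
  obtains (assign) xs D ys where "Ds = xs @ D # ys" "Ds' = xs @ (j # D) # ys"
      "load ds D + cost (ds ! j) \<le> B"
    | (open_new) "Ds' = Ds @ [[j]]" "\<forall>D \<in> set Ds. B < load ds D + cost (ds ! j)"
  using assms
proof cases
  case (assign i)
  then have "Ds = take i Ds @ Ds ! i # drop (Suc i) Ds"
    "Ds' = take i Ds @ (j # Ds ! i) # drop (Suc i) Ds"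
    by (simp_all add: id_take_nth_drop[symmetric] upd_conv_take_nth_drop)
  with assign show ?thesis by (intro that(1)) (auto simp: remaining_def load_def)
next
  case open_new
  then show ?thesis by (intro that(2)) (auto simp: remaining_def load_def)
qed

text \<open>A new drone is opened for cost \<open>c\<close> only if every load exceeds \<open>B - c\<close>. Hence a second
  drone of load at most \<open>B / 2\<close> can never appear.\<close>

definition any_fit_state :: "real \<Rightarrow> delivery list \<Rightarrow> nat list list \<Rightarrow> bool" where
  "any_fit_state B ds Ds \<longleftrightarrow> [] \<notin> set Ds \<and> (\<forall>D \<in> set Ds. load ds D \<le> B) \<and>
     length (filter (\<lambda>D. 2 * load ds D \<le> B) Ds) \<le> 1"

lemma any_fit_state_step:
  assumes "greedy_step B ds j Ds Ds'" "any_fit_state B ds Ds"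
    and c: "0 < cost (ds ! j)" "cost (ds ! j) \<le> B"
  shows "any_fit_state B ds Ds'"
  using assms(1)
proof (cases rule: greedy_stepE)
  case (assign xs D ys)
  \<comment> \<open>Loads only grow, so the chosen drone may leave the list of those with load at
    most \<open>B / 2\<close> but cannot enter it.\<close>
  then show ?thesis using assms(2) c by (auto simp: any_fit_state_def split: if_splits)
next
  case open_new
  show ?thesis
  proof (cases "2 * cost (ds ! j) \<le> B")
    case True
    \<comment> \<open>The new drone itself has load at most \<open>B / 2\<close>, so no earlier one
      may. Each earlier load exceeds \<open>B - cost (ds ! j)\<close>, which is at least
      \<open>B / 2\<close>.\<close>
    have "filter (\<lambda>D. 2 * load ds D \<le> B) Ds = []"
      using open_new(2) True by (force simp: filter_empty_conv)
    then show ?thesis using assms(2) c open_new(1) by (auto simp: any_fit_state_def)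
  next
    case False
    then show ?thesis using assms(2) c open_new(1) by (auto simp: any_fit_state_def)
  qed
qed

lemma any_fit_state_run:
  assumes "greedy_run B ds js Ds Ds'" "any_fit_state B ds Ds"
    and "\<And>j. j \<in> set js \<Longrightarrow> 0 < cost (ds ! j) \<and> cost (ds ! j) \<le> B"
  shows "any_fit_state B ds Ds'"
  using assms by induction (auto intro: any_fit_state_step)

text \<open>Multisets record repetitions, so this one equation yields both that each delivery is
  assigned and that none is assigned twice.\<close>

lemma mset_concat_greedy_run:
  assumes "greedy_run B ds js Ds Ds'"
  shows "mset (concat Ds') = mset js + mset (concat Ds)"
  using assms
proof induction
  case (Cons j Ds Ds' js Ds'')
  from Cons.hyps(1) have "mset (concat Ds') = add_mset j (mset (concat Ds))"
    by (cases rule: greedy_stepE) auto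
  with Cons.IH show ?case by simp
qed simp

text \<open>A drone with load above \<open>B / 2\<close> pays for its share \<open>B\<close> by
  twice its load. Every other drone is charged \<open>B\<close> through the filter count, and its
  nonnegative load does no harm.\<close>

lemma length_times_budget_le:
  assumes "\<And>D. D \<in> set Ds \<Longrightarrow> 0 \<le> load ds D"
  shows "real (length Ds) * B
    \<le> real (length (filter (\<lambda>D. 2 * load ds D \<le> B) Ds)) * B + 2 * load ds (concat Ds)"
  using assms
proof (induction Ds)
  case (Cons D Ds)
  have "0 \<le> load ds D" by (rule Cons.prems) simp
  moreover have "real (length Ds) * B
    \<le> real (length (filter (\<lambda>D. 2 * load ds D \<le> B) Ds)) * B + 2 * load ds (concat Ds)"
    using Cons by simp
  ultimately show ?case by (simp add: algebra_simps)
qed simp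

lemma GreedyAlgoModified_correct:
  assumes "GreedyAlgoModified B ds J Ds" "0 < B"
    and c: "\<And>j. j \<in> J \<Longrightarrow> 0 < cost (ds ! j) \<and> cost (ds ! j) \<le> B"
  shows "distinct (concat Ds)" "set (concat Ds) = J" "[] \<notin> set Ds"
    "\<forall>D \<in> set Ds. load ds D \<le> B"
    "real (length Ds) * B \<le> B + 2 * (\<Sum>j\<in>J. cost (ds ! j))"
proof -
  obtain js where js: "distinct js" "set js = J" "greedy_run B ds js [] Ds"
    using assms(1) by (auto simp: GreedyAlgoModified_def)
  have m: "mset (concat Ds) = mset js"
    using mset_concat_greedy_run[OF js(3)] by simp
  show d: "distinct (concat Ds)" using m js(1) by (metis mset_eq_imp_distinct_iff)
  show s: "set (concat Ds) = J" using m js(2) by (metis mset_eq_setD)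
  have inv: "any_fit_state B ds Ds"
    using any_fit_state_run[OF js(3)] c js(2) by (auto simp: any_fit_state_def)
  then show "[] \<notin> set Ds" "\<forall>D \<in> set Ds. load ds D \<le> B"
    by (auto simp: any_fit_state_def)
  have "0 \<le> load ds D" if "D \<in> set Ds" for D
    using that s c by (intro load_nonneg) (force intro: less_imp_le)
  then have "real (length Ds) * B
    \<le> real (length (filter (\<lambda>D. 2 * load ds D \<le> B) Ds)) * B + 2 * load ds (concat Ds)"
    by (rule length_times_budget_le)
  \<comment> \<open>At most one drone is charged through the filter count. This is the source of the
    one additional drone per colour.\<close>
  moreover have "real (length (filter (\<lambda>D. 2 * load ds D \<le> B) Ds)) * B \<le> 1 * B"
    using inv \<open>0 < B\<close> by (intro mult_right_mono) (auto simp: any_fit_state_def)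
  ultimately show "real (length Ds) * B \<le> B + 2 * (\<Sum>j\<in>J. cost (ds ! j))"
    using load_eq_sum[OF d] s by simp
qed


section \<open>The optimum\<close>

text \<open>The \<open>LEAST\<close> in \<open>OPT\<close> is attained as soon as one feasible
  partition exists. The singletons form one because no single cost exceeds \<open>B\<close>.\<close>

lemma OPT_witness:
  assumes "ddp_instance B ds"
  obtains P where "partition_on (deliveries ds) P" "\<forall>S\<in>P. feasible B ds S" "card P = OPT B ds"
proof -
  let ?Q = "\<lambda>m. \<exists>P. partition_on (deliveries ds) P \<and> (\<forall>S\<in>P. feasible B ds S) \<and> card P = m"
  let ?P = "(\<lambda>j. {j}) ` deliveries ds"
  have "partition_on (deliveries ds) ?P"
    by (rule partition_on_singletons)
  moreover have "\<forall>S\<in>?P. feasible B ds S"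
    using assms by (auto simp: feasible_def ddp_instance_def deliveries_def disjoint_family_on_def)
  ultimately have "?Q (card ?P)" by blast
  then have "?Q (OPT B ds)" unfolding OPT_def by (rule LeastI)
  then show ?thesis using that by blast
qed

text \<open>Each block of an optimal partition carries cost at most \<open>B\<close>, and the blocks
  together carry everything.\<close>

lemma total_cost_le_OPT:
  assumes "ddp_instance B ds"
  shows "(\<Sum>j\<in>deliveries ds. cost (ds ! j)) \<le> real (OPT B ds) * B"
proof -
  obtain P where P: "partition_on (deliveries ds) P" "\<forall>S\<in>P. feasible B ds S"
    "card P = OPT B ds"
    using OPT_witness[OF assms] .
  have "finite (deliveries ds)" by (simp add: deliveries_def)
  then have fin: "\<forall>S\<in>P. finite S" using P(1)
    by (metis partition_onD1 Sup_upper finite_subset)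
  have "(\<Sum>j\<in>deliveries ds. cost (ds ! j)) = (\<Sum>S\<in>P. \<Sum>j\<in>S. cost (ds ! j))"
    using P(1) fin by (subst partition_onD1[OF P(1)], subst sum.Union_disjoint)
      (auto simp: partition_on_def disjoint_def)
  also have "\<dots> \<le> (\<Sum>S\<in>P. B)"
    using P(2) by (intro sum_mono) (auto simp: feasible_def)
  finally show ?thesis using P(3) by simp
qed

section \<open>Combining the colour classes into one solution\<close>

lemma distinct_concatI:
  assumes "distinct ks" "\<And>k. k \<in> set ks \<Longrightarrow> distinct (concat (f k))"
    and "\<And>k l. k \<in> set ks \<Longrightarrow> l \<in> set ks \<Longrightarrow> k \<noteq> l \<Longrightarrow>
      set (concat (f k)) \<inter> set (concat (f l)) = {}"
  shows "distinct (concat (concat (map f ks)))"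
  using assms
proof (induction ks)
  case (Cons k ks)
  have "set (concat (f k)) \<inter> set (concat (f l)) = {}" if "l \<in> set ks" for l
    using Cons.prems that by (intro Cons.prems(3)) auto
  moreover have "distinct (concat (concat (map f ks)))"
    using Cons by auto
  ultimately show ?case using Cons.prems(2)[of k] by fastforce
qed simp

lemma partition_on_set_image:
  assumes "distinct (concat Ds)" "[] \<notin> set Ds"
  shows "partition_on (set (concat Ds)) (set ` set Ds)"
  using assms unfolding partition_on_def disjoint_def
  by (auto simp: distinct_concat_iff)

text \<open>Time and budget are settled separately: disjointness of the intervals on one drone comes
  from the colouring, since a drone serves a single colour, and the cost bound comes from the greedy
  invariant.\<close>

lemma ApprxAlgoWithColouring_correct:
  assumes inst: "ddp_instance B ds" and alg: "ApprxAlgoWithColouring B ds out"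
  shows "ddp_solution B ds out" "length out \<le> 2 * OPT B ds + clique_number ds"
proof -
  let ?w = "clique_number ds"
  obtain \<kappa> outs where col: "proper_colouring ds ?w \<kappa>"
    and gr: "\<And>k. k \<in> {1..?w} \<Longrightarrow> GreedyAlgoModified B ds {j \<in> deliveries ds. \<kappa> j = k} (outs k)"
    and out: "out = concat (map outs [1..<Suc ?w])"
    using alg unfolding ApprxAlgoWithColouring_def by blast
  have B: "0 < B" using inst by (simp add: ddp_instance_def)
  have c: "0 < cost (ds ! j) \<and> cost (ds ! j) \<le> B" if "j \<in> deliveries ds" for j
    using inst that by (auto simp: ddp_instance_def deliveries_def)
  let ?J = "\<lambda>k. {j \<in> deliveries ds. \<kappa> j = k}"
  have corr: "distinct (concat (outs k))" "set (concat (outs k)) = ?J k" "[] \<notin> set (outs k)"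
    "\<forall>D \<in> set (outs k). load ds D \<le> B"
    "real (length (outs k)) * B \<le> B + 2 * (\<Sum>j\<in>?J k. cost (ds ! j))" if "k \<in> {1..?w}" for k
    using GreedyAlgoModified_correct[OF gr[OF that] B] c by blast+
  have dist: "distinct (concat out)"
    unfolding out using corr(1,2)
    by (intro distinct_concatI) (auto simp del: upt_Suc set_concat)
  have set_out: "set out = (\<Union>k\<in>{1..?w}. set (outs k))"
    by (simp add: out atLeastLessThanSuc_atLeastAtMost del: upt_Suc)
  have range: "\<kappa> j \<in> {1..?w}" if "j \<in> deliveries ds" for j
    using col that by (auto simp: proper_colouring_def)
  have "set (concat out) = (\<Union>k\<in>{1..?w}. set (concat (outs k)))"
    by (auto simp: set_out)
  also have "\<dots> = deliveries ds"
    using range by (auto simp: corr(2) simp del: set_concat)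
  finally have cover: "set (concat out) = deliveries ds" .
  have ne: "[] \<notin> set out" using corr(3) by (auto simp: set_out)
  have feas: "feasible B ds (set D)" if "D \<in> set out" for D
  proof -
    obtain k where k: "k \<in> {1..?w}" "D \<in> set (outs k)" using \<open>D \<in> set out\<close> set_out by auto
    have "distinct D" using dist that by (auto simp: distinct_concat_iff)
    have J: "set D \<subseteq> ?J k" using corr(2)[OF k(1)] k(2) by auto
    have "ivl ds i \<inter> ivl ds j = {}" if "i \<in> set D" "j \<in> set D" "i \<noteq> j" for i j
    proof (rule ccontr)
      assume "ivl ds i \<inter> ivl ds j \<noteq> {}"
      then have "{i, j} \<in> interval_graph ds"
        using that J unfolding interval_graph_def by blast
      then have "\<kappa> i \<noteq> \<kappa> j" using col by (simp add: proper_colouring_def)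
      then show False using that J by auto
    qed
    then show ?thesis
      using corr(4)[OF k(1)] k(2) load_eq_sum[OF \<open>distinct D\<close>, of ds]
      by (auto simp: feasible_def disjoint_family_on_def)
  qed
  show "ddp_solution B ds out"
    using dist partition_on_set_image[OF dist ne] cover feas by (simp add: ddp_solution_def)
  have "length out = (\<Sum>k\<in>{1..?w}. length (outs k))"
    by (simp add: out length_concat comp_def sum_list_distinct_conv_sum_set
        atLeastLessThanSuc_atLeastAtMost del: upt_Suc)
  \<comment> \<open>The count is scaled by \<open>B\<close> to compare it with costs; the factor is
    cancelled at the end because \<open>B\<close> is positive.\<close>
  then have "real (length out) * B = (\<Sum>k\<in>{1..?w}. real (length (outs k)) * B)"
    by (simp add: sum_distrib_right)
  also have "\<dots> \<le> (\<Sum>k\<in>{1..?w}. B + 2 * (\<Sum>j\<in>?J k. cost (ds ! j)))"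
    by (intro sum_mono corr(5))
  also have "\<dots> = real ?w * B + 2 * (\<Sum>k\<in>{1..?w}. \<Sum>j\<in>?J k. cost (ds ! j))"
    by (simp add: sum.distrib sum_distrib_left)
  \<comment> \<open>Every delivery has exactly one colour in the range, so the class sums regroup
    into the total cost.\<close>
  also have "(\<Sum>k\<in>{1..?w}. \<Sum>j\<in>?J k. cost (ds ! j)) = (\<Sum>j\<in>deliveries ds. cost (ds ! j))"
    using range by (intro sum.group) (auto simp: deliveries_def)
  also have "real ?w * B + 2 * \<dots> \<le> real (2 * OPT B ds + ?w) * B"
    using total_cost_le_OPT[OF inst] by (simp add: algebra_simps)
  finally show "length out \<le> 2 * OPT B ds + ?w"
    using B by (simp only: mult_le_cancel_right_pos of_nat_le_iff)
qed

section \<open>The implementation\<close>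

lemma index_from_eq: "index_from i ds = [i..<i + length ds]"
  by (induction i ds rule: index_from.induct) (simp_all add: upt_conv_Cons del: upt_Suc)

lemma mset_insort_left [simp]: "mset (insort_left ds j ks) = add_mset j (mset ks)"
  by (induction ds j ks rule: insort_left.induct) auto

lemma mset_isort_left [simp]: "mset (isort_left ds js) = mset js"
  by (induction ds js rule: isort_left.induct) auto

lemma set_insort_left [simp]: "set (insort_left ds j ks) = insert j (set ks)"
  by (metis mset_insort_left set_mset_add_mset_insert set_mset_mset)

lemma sorted_insort_left:
  "sorted_wrt (\<lambda>i k. tL (ds ! i) \<le> tL (ds ! k)) ks \<Longrightarrow>
   sorted_wrt (\<lambda>i k. tL (ds ! i) \<le> tL (ds ! k)) (insort_left ds j ks)"
  by (induction ds j ks rule: insort_left.induct) (auto intro: order_trans)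

lemma sorted_isort_left: "sorted_wrt (\<lambda>i k. tL (ds ! i) \<le> tL (ds ! k)) (isort_left ds js)"
  by (induction ds js rule: isort_left.induct) (auto intro: sorted_insort_left)

section \<open>First-fit colouring\<close>

text \<open>For nonempty closed intervals this is intersection, phrased by the endpoint comparisons
  that \<open>conflict\<close> makes.\<close>

definition overlap :: "delivery list \<Rightarrow> nat \<Rightarrow> nat \<Rightarrow> bool" where
  "overlap ds i k \<longleftrightarrow> tL (ds ! i) \<le> tR (ds ! k) \<and> tL (ds ! k) \<le> tR (ds ! i)"

lemma conflict_iff: "conflict ds j C \<longleftrightarrow> (\<exists>k\<in>set C. overlap ds j k)"
  by (induction ds j C rule: conflict.induct) (auto simp: overlap_def)

text \<open>The analogue of \<open>greedy_stepE\<close>: either one class is extended or a singleton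
  class is appended, in a form that makes multiset, independence and size facts immediate.\<close>

lemma first_fitE:
  obtains (fits) xs C ys where "Cs = xs @ C # ys" "first_fit ds j Cs = xs @ (j # C) # ys"
      "\<not> conflict ds j C"
    | (open_new) "first_fit ds j Cs = Cs @ [[j]]" "\<forall>C \<in> set Cs. conflict ds j C"
proof (induction Cs arbitrary: thesis)
  case (Cons C Cs)
  show ?case
  proof (cases "conflict ds j C")
    case True
    show ?thesis
    proof (rule Cons.IH)
      fix xs C' ys
      assume "Cs = xs @ C' # ys" "first_fit ds j Cs = xs @ (j # C') # ys" "\<not> conflict ds j C'"
      then show ?thesis using True by (intro Cons.prems(1)[of "C # xs" C' ys]) auto
    next
      assume "first_fit ds j Cs = Cs @ [[j]]" "\<forall>C \<in> set Cs. conflict ds j C"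
      then show ?thesis using True by (intro Cons.prems(2)) auto
    qed
  next
    case False
    then show ?thesis by (intro Cons.prems(1)[of "[]" C Cs]) auto
  qed
qed simp

lemma mset_concat_first_fit: "mset (concat (first_fit ds j Cs)) = add_mset j (mset (concat Cs))"
  by (cases rule: first_fitE[of Cs ds j]) auto

lemma mset_concat_colour_classes:
  "mset (concat (colour_classes ds js Cs)) = mset js + mset (concat Cs)"
  by (induction ds js Cs rule: colour_classes.induct) (simp_all add: mset_concat_first_fit)

lemma card_le_clique_number:
  assumes "K \<subseteq> deliveries ds" "clique K (interval_graph ds)"
  shows "card K \<le> clique_number ds"
proof -
  let ?A = "{card K | K. K \<subseteq> deliveries ds \<and> clique K (interval_graph ds)}"
  \<comment> \<open>\<open>Max\<close> bounds only finite sets from above; the clique sizes are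
    cardinalities of subsets of a finite set.\<close>
  have "?A \<subseteq> card ` Pow (deliveries ds)" by auto
  then have "finite ?A" by (rule finite_subset) (simp add: deliveries_def)
  then show ?thesis unfolding clique_number_def using assms by (intro Max_ge) auto
qed

text \<open>Intervals that start no later than \<open>j\<close> and meet \<open>j\<close> all contain the left endpoint of
  \<open>j\<close>, so one such interval from each class forms a clique together with \<open>j\<close>.\<close>

lemma all_conflict_imp_clique:
  assumes inst: "ddp_instance B ds" and conf: "\<forall>C \<in> set Cs. conflict ds j C"
    and dist: "distinct (concat Cs)" and j: "j \<notin> set (concat Cs)"
    and dels: "insert j (set (concat Cs)) \<subseteq> deliveries ds"
    and left: "\<forall>k \<in> set (concat Cs). tL (ds ! k) \<le> tL (ds ! j)"
  shows "length Cs < clique_number ds"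
proof -
  have "\<forall>C \<in> set Cs. \<exists>k. k \<in> set C \<and> overlap ds j k"
    using conf by (auto simp: conflict_iff)
  then obtain f where f: "\<And>C. C \<in> set Cs \<Longrightarrow> f C \<in> set C \<and> overlap ds j (f C)"
    by metis
  let ?K = "insert j (f ` set Cs)"
  \<comment> \<open>An empty class has no conflict. With all classes nonempty, disjointness makes
    them distinct as lists, so counting classes agrees with counting representatives.\<close>
  have "[] \<notin> set Cs" using f by force
  then have "distinct Cs" using dist by (simp add: distinct_concat_iff)
  have inj: "inj_on f (set Cs)"
  proof (rule inj_onI)
    fix C C' assume "C \<in> set Cs" "C' \<in> set Cs" "f C = f C'"
    then have "f C \<in> set C \<inter> set C'" using f by (metis IntI)
    then show "C = C'" using dist \<open>C \<in> set Cs\<close> \<open>C' \<in> set Cs\<close>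
      unfolding distinct_concat_iff by blast
  qed
  have sub: "f ` set Cs \<subseteq> set (concat Cs)" using f by auto
  \<comment> \<open>The delivery \<open>j\<close> lies in no class and adds one vertex to the
    representatives; this makes the inequality strict.\<close>
  have "card ?K = Suc (length Cs)"
    using j sub inj \<open>distinct Cs\<close> by (subst card_insert_disjoint) (auto simp: card_image distinct_card)
  have mem: "tL (ds ! j) \<in> ivl ds k" if "k \<in> ?K" for k
  proof (cases "k = j")
    case True
    have "ds ! j \<in> set ds" using dels by (simp add: deliveries_def)
    then show ?thesis using inst True by (simp add: ivl_def ddp_instance_def)
  next
    case False
    then have "k \<in> set (concat Cs)" "overlap ds j k" using that f sub by blast+
    then show ?thesis using left by (auto simp: ivl_def overlap_def)
  qed
  have "?K \<subseteq> deliveries ds" using dels sub by blast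
  moreover have "clique ?K (interval_graph ds)"
    unfolding clique_def
  proof (intro ballI impI)
    fix v w assume "v \<in> ?K" "w \<in> ?K" "v \<noteq> w"
    moreover from this have "ivl ds v \<inter> ivl ds w \<noteq> {}" using mem by blast
    ultimately show "{v, w} \<in> interval_graph ds"
      using \<open>?K \<subseteq> deliveries ds\<close> unfolding interval_graph_def by blast
  qed
  ultimately have "card ?K \<le> clique_number ds" by (rule card_le_clique_number)
  then show ?thesis using \<open>card ?K = Suc (length Cs)\<close> by simp
qed

text \<open>Invariant of first-fit: the classes form a partial proper colouring with at most
  \<omega> colours. Excluding empty classes lets \<open>distinct (concat Cs)\<close> imply
  \<open>distinct Cs\<close>, so a delivery determines the index of its class.\<close>

definition independent_classes :: "delivery list \<Rightarrow> nat list list \<Rightarrow> bool" where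
  "independent_classes ds Cs \<longleftrightarrow> [] \<notin> set Cs \<and> length Cs \<le> clique_number ds \<and>
     (\<forall>C \<in> set Cs. \<forall>i \<in> set C. \<forall>k \<in> set C. i \<noteq> k \<longrightarrow> \<not> overlap ds i k)"

text \<open>Extending a class without conflict keeps it independent. A class is opened only when all
  conflict with \<open>j\<close>, and then the clique through \<open>j\<close> shows that a colour
  is still free.\<close>

lemma independent_classes_first_fit:
  assumes "ddp_instance B ds" "independent_classes ds Cs" "distinct (concat Cs)"
    "j \<notin> set (concat Cs)" "insert j (set (concat Cs)) \<subseteq> deliveries ds"
    "\<forall>k \<in> set (concat Cs). tL (ds ! k) \<le> tL (ds ! j)"
  shows "independent_classes ds (first_fit ds j Cs)"
proof (cases rule: first_fitE[of Cs ds j])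
  case (fits xs C ys)
  then show ?thesis using assms(2)
    by (fastforce simp: independent_classes_def conflict_iff overlap_def)
next
  case open_new
  then have "length Cs < clique_number ds"
    using all_conflict_imp_clique assms by blast
  then show ?thesis using open_new(1) assms(2) by (auto simp: independent_classes_def)
qed

text \<open>Since \<open>js\<close> is sorted, coloured deliveries start no later than those still
  to come, so the single-step lemma applies at every stage.\<close>

lemma independent_classes_colour_classes:
  assumes "ddp_instance B ds" "independent_classes ds Cs"
    "sorted_wrt (\<lambda>i k. tL (ds ! i) \<le> tL (ds ! k)) js"
    "\<forall>k \<in> set (concat Cs). \<forall>j \<in> set js. tL (ds ! k) \<le> tL (ds ! j)"
    "distinct (concat Cs @ js)" "set (concat Cs @ js) \<subseteq> deliveries ds"
  shows "independent_classes ds (colour_classes ds js Cs)"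
  using assms(2-)
proof (induction js arbitrary: Cs)
  case (Cons j js)
  have m: "mset (concat (first_fit ds j Cs)) = mset (j # concat Cs)"
    by (simp add: mset_concat_first_fit)
  have s: "set (concat (first_fit ds j Cs)) = insert j (set (concat Cs))"
    using mset_eq_setD[OF m] by (simp del: set_concat)
  have "independent_classes ds (first_fit ds j Cs)"
    using Cons.prems assms(1) by (intro independent_classes_first_fit) auto
  moreover have "distinct (concat (first_fit ds j Cs) @ js)"
    using mset_eq_imp_distinct_iff[OF m] Cons.prems(4) s by (auto simp del: set_concat)
  ultimately have "independent_classes ds (colour_classes ds js (first_fit ds j Cs))"
    using Cons.prems(2-5) s by (intro Cons.IH) (auto simp del: set_concat)
  then show ?case by simp
qed simp

section \<open>The computed greedy assignment\<close>

lemma rem_cap_eq: "rem_cap B ds D = remaining B ds D"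
  by (induction B ds D rule: rem_cap.induct) (simp_all add: remaining_def)

lemma max_cap_ge: "m \<le> max_cap B ds m Ds" "D \<in> set Ds \<Longrightarrow> remaining B ds D \<le> max_cap B ds m Ds"
  by (induction B ds m Ds rule: max_cap.induct) (auto simp: rem_cap_eq)

lemma max_cap_attained: "max_cap B ds m Ds = m \<or> (\<exists>D \<in> set Ds. max_cap B ds m Ds = remaining B ds D)"
  by (induction B ds m Ds rule: max_cap.induct) (auto simp: rem_cap_eq max_def)

text \<open>Exposes the updated position in the index form of \<open>greedy_step.assign\<close>. The
  hypothesis rules out reaching the end of the list, where \<open>place\<close> would drop
  \<open>j\<close>.\<close>

lemma place_eq_update:
  assumes "\<exists>D \<in> set Ds. m \<le> remaining B ds D"
  shows "\<exists>i < length Ds. place B ds j m Ds = Ds[i := j # Ds ! i] \<and> m \<le> remaining B ds (Ds ! i)"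
  using assms
proof (induction Ds)
  case (Cons D Ds)
  show ?case
  proof (cases "m \<le> remaining B ds D")
    case True
    then show ?thesis by (intro exI[of _ 0]) (simp add: rem_cap_eq)
  next
    case False
    with Cons obtain i where "i < length Ds" "place B ds j m Ds = Ds[i := j # Ds ! i]"
      "m \<le> remaining B ds (Ds ! i)" by auto
    with False show ?thesis by (intro exI[of _ "Suc i"]) (simp add: rem_cap_eq)
  qed
qed simp

lemma greedy_step_assign_delivery:
  assumes "0 < cost (ds ! j)"
  shows "greedy_step B ds j Ds (assign_delivery B ds j Ds)"
proof (cases "cost (ds ! j) \<le> max_cap B ds 0 Ds")
  case True
  let ?m = "max_cap B ds 0 Ds"
  \<comment> \<open>The maximum is at least a positive cost, so it is not the initial value 0 and
    some drone attains it.\<close>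
  have "\<exists>D \<in> set Ds. ?m \<le> remaining B ds D"
    using max_cap_attained[of B ds 0 Ds] True assms by auto
  then obtain i where i: "i < length Ds" "place B ds j ?m Ds = Ds[i := j # Ds ! i]"
    "?m \<le> remaining B ds (Ds ! i)" using place_eq_update by blast
  have "greedy_step B ds j Ds (Ds[i := j # Ds ! i])"
    using i True max_cap_ge(2)[of _ Ds B ds 0] by (intro greedy_step.assign) (auto intro: order_trans)
  then show ?thesis using True i by (simp add: Let_def)
next
  case False
  have "greedy_step B ds j Ds (Ds @ [[j]])"
    using False max_cap_ge(2)[of _ Ds B ds 0] by (intro greedy_step.open_new) force
  then show ?thesis using False by (simp add: Let_def)
qed

lemma greedy_run_greedy:
  "(\<And>j. j \<in> set js \<Longrightarrow> 0 < cost (ds ! j)) \<Longrightarrow> greedy_run B ds js Ds (greedy B ds js Ds)"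
proof (induction js arbitrary: Ds)
  case (Cons j js)
  have "greedy_step B ds j Ds (assign_delivery B ds j Ds)"
    using Cons.prems by (intro greedy_step_assign_delivery) simp
  moreover have "greedy_run B ds js (assign_delivery B ds j Ds)
      (greedy B ds js (assign_delivery B ds j Ds))"
    using Cons.prems by (intro Cons.IH) simp
  ultimately show ?case by (simp add: greedy_run.Cons del: assign_delivery.simps)
qed (simp add: greedy_run.Nil)

section \<open>The implementation as a run of the algorithm\<close>

lemma greedy_classes_eq: "greedy_classes B ds Cs = concat (map (\<lambda>C. greedy B ds C []) Cs)"
  by (induction B ds Cs rule: greedy_classes.induct) simp_all

text \<open>A colouring function is read off from the list of classes. First-fit may open fewer than
  \<omega> classes; the surplus colours are filled with empty outputs.\<close>

lemma ApprxAlgoWithColouring_apprx_algo: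
  assumes inst: "ddp_instance B ds"
  shows "ApprxAlgoWithColouring B ds (apprx_algo B ds)"
proof -
  let ?w = "clique_number ds"
  define js where "js = isort_left ds (index_from 0 ds)"
  define Cs where "Cs = colour_classes ds js []"
  let ?l = "length Cs"
  have mjs: "mset js = mset [0..<length ds]" by (simp add: js_def index_from_eq)
  have js: "distinct js" "set js = deliveries ds"
    using mset_eq_imp_distinct_iff[OF mjs] mset_eq_setD[OF mjs]
    by (simp_all add: deliveries_def atLeast0LessThan)
  have ind: "independent_classes ds Cs"
    unfolding Cs_def using inst js sorted_isort_left
    by (intro independent_classes_colour_classes) (auto simp: independent_classes_def js_def)
  have mCs: "mset (concat Cs) = mset js"
    unfolding Cs_def mset_concat_colour_classes by simp
  have dist: "distinct (concat Cs)" and cover: "set (concat Cs) = deliveries ds"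
    using mset_eq_imp_distinct_iff[OF mCs] mset_eq_setD[OF mCs] js by (simp_all del: set_concat)
  have "distinct Cs" using dist ind by (simp add: distinct_concat_iff independent_classes_def)
  \<comment> \<open>Colours start at 1 and list positions at 0, hence \<open>Suc\<close>. The
    position is unique because the classes are distinct and share no delivery.\<close>
  define \<kappa> where "\<kappa> j = Suc (THE i. i < ?l \<and> j \<in> set (Cs ! i))" for j
  have \<kappa>_eq: "\<kappa> j = Suc i" if "i < ?l" "j \<in> set (Cs ! i)" for i j
  proof -
    have "i' = i" if "i' < ?l" "j \<in> set (Cs ! i')" for i'
    proof -
      have "Cs ! i' = Cs ! i"
        using dist that \<open>i < ?l\<close> \<open>j \<in> set (Cs ! i)\<close> nth_mem unfolding distinct_concat_iff by blast
      then show ?thesis using that \<open>i < ?l\<close> \<open>distinct Cs\<close> by (simp add: nth_eq_iff_index_eq)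
    qed
    then have "(THE i. i < ?l \<and> j \<in> set (Cs ! i)) = i"
      using that by (intro the_equality conjI) blast+
    then show ?thesis by (simp add: \<kappa>_def)
  qed
  have index: "\<exists>i < ?l. j \<in> set (Cs ! i)" if "j \<in> deliveries ds" for j
    using that unfolding cover[symmetric] by (metis UN_E in_set_conv_nth set_concat)
  have lw: "?l \<le> ?w" using ind by (simp add: independent_classes_def)
  have "proper_colouring ds ?w \<kappa>"
    unfolding proper_colouring_def
  proof (intro conjI allI impI)
    show "\<kappa> ` deliveries ds \<subseteq> {1..?w}" using index \<kappa>_eq lw by fastforce
  next
    fix i j assume "{i, j} \<in> interval_graph ds"
    then have ij: "i \<in> deliveries ds" "j \<in> deliveries ds" "i \<noteq> j" "ivl ds i \<inter> ivl ds j \<noteq> {}"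
      by (auto simp: interval_graph_def doubleton_eq_iff)
    from ij(4) have "overlap ds i j" by (auto simp: ivl_def overlap_def)
    show "\<kappa> i \<noteq> \<kappa> j"
    proof
      assume "\<kappa> i = \<kappa> j"
      obtain a b where "a < ?l" "i \<in> set (Cs ! a)" "b < ?l" "j \<in> set (Cs ! b)"
        using index ij by blast
      moreover from this have "a = b" using \<open>\<kappa> i = \<kappa> j\<close> \<kappa>_eq by force
      ultimately show False
        using ind \<open>i \<noteq> j\<close> \<open>overlap ds i j\<close> nth_mem unfolding independent_classes_def by blast
    qed
  qed
  \<comment> \<open>Colour \<open>k\<close> belongs to position \<open>k - 1\<close>. Colours above
    \<open>?l\<close> have no deliveries and contribute no drones, so the concatenation over all
    \<omega> colours is unchanged.\<close>
  moreover define outs where "outs k = (if k \<le> ?l then greedy B ds (Cs ! (k - 1)) [] else [])" for k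
  have "GreedyAlgoModified B ds {j \<in> deliveries ds. \<kappa> j = k} (outs k)" if k: "k \<in> {1..?w}" for k
  proof (cases "k \<le> ?l")
    case True
    let ?C = "Cs ! (k - 1)"
    have "?C \<in> set Cs" using True k by (intro nth_mem) auto
    have C: "set ?C = {j \<in> deliveries ds. \<kappa> j = k}"
    proof (intro set_eqI iffI)
      fix j assume "j \<in> set ?C"
      then show "j \<in> {j \<in> deliveries ds. \<kappa> j = k}"
        using \<open>?C \<in> set Cs\<close> cover \<kappa>_eq[of "k - 1" j] True k by auto
    next
      fix j assume j: "j \<in> {j \<in> deliveries ds. \<kappa> j = k}"
      then obtain i where "i < ?l" "j \<in> set (Cs ! i)" using index by blast
      with j \<kappa>_eq show "j \<in> set ?C" by auto
    qed
    have "distinct ?C" using dist \<open>?C \<in> set Cs\<close> by (auto simp: distinct_concat_iff)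
    moreover have "greedy_run B ds ?C [] (outs k)"
      using True C inst by (auto simp: outs_def ddp_instance_def deliveries_def intro!: greedy_run_greedy)
    ultimately show ?thesis using C unfolding GreedyAlgoModified_def by blast
  next
    case False
    then have "{j \<in> deliveries ds. \<kappa> j = k} = {}" using index \<kappa>_eq by fastforce
    then show ?thesis using False unfolding GreedyAlgoModified_def outs_def
      by (intro exI[of _ "[]"]) (simp add: greedy_run.Nil)
  qed
  moreover have "apprx_algo B ds = concat (map outs [1..<Suc ?w])"
  proof -
    have "[1..<Suc ?w] = [1..<Suc ?l] @ [Suc ?l..<Suc ?w]"
      using lw upt_add_eq_append[of 1 "Suc ?l" "?w - ?l"] by (simp del: upt_Suc)
    moreover have "concat (map outs [Suc ?l..<Suc ?w]) = []"
      by (auto simp: outs_def simp del: upt_Suc)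
    moreover have "map outs [1..<Suc ?l] = map (\<lambda>C. greedy B ds C []) Cs"
      by (intro nth_equalityI) (auto simp: outs_def simp del: upt_Suc)
    ultimately show ?thesis by (simp add: greedy_classes_eq Cs_def js_def del: upt_Suc)
  qed
  ultimately show ?thesis unfolding ApprxAlgoWithColouring_def by blast
qed


section \<open>Running time\<close>

lemma T_nth_le: "j \<in> deliveries ds \<Longrightarrow> T_nth ds j \<le> Suc (length ds)"
  by (simp add: T_nth deliveries_def)

lemma T_index_from_eq: "T_index_from i ds = Suc (length ds)"
  by (induction i ds rule: T_index_from.induct) auto

text \<open>Each call makes two list accesses of at most \<open>length ds + 1\<close> steps and
  costs one step itself, which gives \<open>2 * length ds + 3\<close>. The factors
  \<open>4 * length ds + 5\<close> and \<open>length ds + 2\<close> below arise likewise from four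
  accesses and one.\<close>

lemma T_insort_left_le:
  assumes "insert j (set ks) \<subseteq> deliveries ds"
  shows "T_insort_left ds j ks \<le> (2 * length ds + 3) * length ks + 1"
  using assms
proof (induction ks)
  case (Cons k ks)
  then show ?case using T_nth_le[of j ds] T_nth_le[of k ds] by auto
qed simp

lemma T_isort_left_le:
  assumes "set js \<subseteq> deliveries ds"
  shows "T_isort_left ds js \<le> length js * ((2 * length ds + 3) * length js + 2) + 1"
  using assms
proof (induction js)
  case (Cons j js)
  let ?a = "2 * length ds + 3"
  have "set (isort_left ds js) = set js" by (metis mset_isort_left mset_eq_setD)
  then have "insert j (set (isort_left ds js)) \<subseteq> deliveries ds" using Cons.prems by simp
  note insort = T_insort_left_le[OF this]
  have len: "length (isort_left ds js) = length js" by (metis mset_isort_left size_mset)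
  have "T_isort_left ds (j # js) \<le> length js * (?a * length js + 2) + 1 + (?a * length js + 1) + 1"
    using Cons insort unfolding len by simp
  also have "\<dots> \<le> length (j # js) * (?a * length (j # js) + 2) + 1"
    by (simp add: algebra_simps)
  finally show ?case .
qed simp

text \<open>Counting both the lists and their elements bounds the time of a pass over a list of lists
  without assuming that no list is empty.\<close>

definition total_size :: "nat list list \<Rightarrow> nat" where
  "total_size Cs = length Cs + length (concat Cs)"

lemma total_size_simps [simp]:
  "total_size [] = 0"
  "total_size (C # Cs) = Suc (length C + total_size Cs)"
  "total_size (Cs @ Ds) = total_size Cs + total_size Ds"
  by (simp_all add: total_size_def)

lemma length_le_total_size: "length Cs \<le> total_size Cs"
  by (simp add: total_size_def)

section \<open>Cost of the colouring\<close>

lemma T_conflict_le: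
  assumes "insert j (set C) \<subseteq> deliveries ds"
  shows "T_conflict ds j C \<le> (4 * length ds + 5) * length C + 1"
  using assms
proof (induction C)
  case (Cons k C)
  then show ?case using T_nth_le[of j ds] T_nth_le[of k ds] by auto
qed simp

text \<open>The constant cost of visiting a class is absorbed by the unit that
  \<open>total_size\<close> counts for the class itself.\<close>

lemma T_first_fit_le:
  assumes "insert j (set (concat Cs)) \<subseteq> deliveries ds"
  shows "T_first_fit ds j Cs \<le> (4 * length ds + 5) * total_size Cs + 1"
  using assms
proof (induction Cs)
  case (Cons C Cs)
  then show ?case using T_conflict_le[of j C ds] by (auto simp: algebra_simps)
qed simp

text \<open>Opening a class adds one list and one element, hence 2.\<close>

lemma total_size_first_fit: "total_size (first_fit ds j Cs) \<le> total_size Cs + 2"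
  by (cases rule: first_fitE[of Cs ds j]) auto

text \<open>The quantity \<open>total_size Cs + 2 * length js\<close> never increases along the
  recursion: one delivery is consumed and the size grows by at most 2. Every step can thus be
  charged at its initial value.\<close>

lemma T_colour_classes_le:
  assumes "set js \<subseteq> deliveries ds" "set (concat Cs) \<subseteq> deliveries ds"
  shows "T_colour_classes ds js Cs
    \<le> length js * ((4 * length ds + 5) * (total_size Cs + 2 * length js) + 2) + 1"
  using assms
proof (induction js arbitrary: Cs)
  case (Cons j js)
  let ?a = "4 * length ds + 5" and ?s = "total_size Cs + 2 * length (j # js)"
  have "set (concat (first_fit ds j Cs)) \<subseteq> deliveries ds"
    using mset_eq_setD[of "concat (first_fit ds j Cs)" "j # concat Cs"] Cons.prems
    by (simp add: mset_concat_first_fit del: set_concat)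
  then have IH: "T_colour_classes ds js (first_fit ds j Cs)
      \<le> length js * (?a * (total_size (first_fit ds j Cs) + 2 * length js) + 2) + 1"
    using Cons.prems by (intro Cons.IH) auto
  have fit: "T_first_fit ds j Cs \<le> ?a * total_size Cs + 1"
    using Cons.prems by (intro T_first_fit_le) auto
  have "total_size (first_fit ds j Cs) + 2 * length js \<le> ?s"
    using total_size_first_fit[of ds j Cs] by simp
  then have "length js * (?a * (total_size (first_fit ds j Cs) + 2 * length js) + 2)
      \<le> length js * (?a * ?s + 2)"
    by (meson add_le_mono1 mult_le_mono2)
  moreover have "?a * total_size Cs \<le> ?a * ?s" by (intro mult_le_mono) auto
  ultimately have "T_colour_classes ds (j # js) Cs
      \<le> (?a * ?s + 1) + (length js * (?a * ?s + 2) + 1) + 1"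
    using IH fit unfolding T_colour_classes.simps by linarith
  then show ?case by (simp add: algebra_simps)
qed simp

section \<open>Cost of the greedy phase\<close>

lemma T_rem_cap_le:
  assumes "set D \<subseteq> deliveries ds"
  shows "T_rem_cap B ds D \<le> (length ds + 2) * length D + 1"
  using assms
proof (induction D)
  case (Cons j D)
  then show ?case using T_nth_le[of j ds] by auto
qed simp

lemma T_max_cap_le:
  assumes "set (concat Ds) \<subseteq> deliveries ds"
  shows "T_max_cap B ds m Ds \<le> (length ds + 2) * total_size Ds + 1"
  using assms
proof (induction Ds arbitrary: m)
  case (Cons D Ds)
  show ?case using Cons.IH[of "max m (rem_cap B ds D)"] Cons.prems T_rem_cap_le[of D ds B]
    by (auto simp: algebra_simps)
qed simp

lemma T_place_le:
  assumes "set (concat Ds) \<subseteq> deliveries ds"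
  shows "T_place B ds j m Ds \<le> (length ds + 2) * total_size Ds + 1"
  using assms
proof (induction Ds)
  case (Cons D Ds)
  then show ?case using T_rem_cap_le[of D ds B] by (auto simp: algebra_simps)
qed simp

lemma T_assign_delivery_le:
  assumes "insert j (set (concat Ds)) \<subseteq> deliveries ds"
  shows "T_assign_delivery B ds j Ds \<le> 2 * (length ds + 2) * total_size Ds + length ds + 3"
proof -
  let ?m = "max_cap B ds 0 Ds" and ?b = "(length ds + 2) * total_size Ds"
  \<comment> \<open>Appending is linear in the number of drones, so it fits under the bound for
    \<open>T_place\<close> and both branches are treated alike.\<close>
  have "1 * total_size Ds \<le> ?b" by (intro mult_le_mono) auto
  then have "T_append Ds [[j]] \<le> ?b + 1"
    using length_le_total_size[of Ds] by (simp add: T_append)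
  then have "(if cost (ds ! j) \<le> ?m then T_place B ds j ?m Ds else T_append Ds [[j]]) \<le> ?b + 1"
    using T_place_le[of Ds ds B j ?m] assms by simp
  then show ?thesis
    using T_max_cap_le[of Ds ds B 0] T_nth_le[of j ds] assms
    unfolding T_assign_delivery.simps Let_def by simp
qed

lemma total_size_place: "total_size (place B ds j m Ds) \<le> total_size Ds + 1"
  by (induction Ds) auto

lemma set_concat_place: "set (concat (place B ds j m Ds)) \<subseteq> insert j (set (concat Ds))"
  by (induction Ds) auto

lemma set_concat_assign_delivery:
  "set (concat (assign_delivery B ds j Ds)) \<subseteq> insert j (set (concat Ds))"
  using set_concat_place[of B ds j "max_cap B ds 0 Ds" Ds] by (simp add: Let_def)

lemma total_size_assign_delivery:
  "total_size (assign_delivery B ds j Ds) \<le> total_size Ds + 2"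
  using total_size_place[of B ds j _ Ds] by (auto simp: Let_def intro: le_SucI)

lemma total_size_greedy: "total_size (greedy B ds js Ds) \<le> total_size Ds + 2 * length js"
proof (induction js arbitrary: Ds)
  case (Cons j js)
  show ?case
    using Cons[of "assign_delivery B ds j Ds"] total_size_assign_delivery[of B ds j Ds]
    by (simp del: assign_delivery.simps)
qed simp

text \<open>The same nonincreasing quantity as for \<open>T_colour_classes_le\<close>, now with
  drones in place of classes.\<close>

lemma T_greedy_le:
  assumes "set js \<subseteq> deliveries ds" "set (concat Ds) \<subseteq> deliveries ds"
  shows "T_greedy B ds js Ds
    \<le> length js * (2 * (length ds + 2) * (total_size Ds + 2 * length js) + length ds + 4) + 1"
  using assms
proof (induction js arbitrary: Ds)
  case (Cons j js)
  let ?a = "2 * (length ds + 2)" and ?s = "total_size Ds + 2 * length (j # js)"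
  let ?Ds = "assign_delivery B ds j Ds"
  have "insert j (set (concat Ds)) \<subseteq> deliveries ds" using Cons.prems by simp
  then have step: "T_assign_delivery B ds j Ds \<le> ?a * total_size Ds + length ds + 3"
    and "set (concat ?Ds) \<subseteq> deliveries ds"
    using T_assign_delivery_le set_concat_assign_delivery[of B ds j Ds] by blast+
  then have IH: "T_greedy B ds js ?Ds
      \<le> length js * (?a * (total_size ?Ds + 2 * length js) + length ds + 4) + 1"
    using Cons.prems by (intro Cons.IH) auto
  have "total_size ?Ds + 2 * length js \<le> ?s"
    using total_size_assign_delivery[of B ds j Ds] by simp
  then have "length js * (?a * (total_size ?Ds + 2 * length js) + length ds + 4)
      \<le> length js * (?a * ?s + length ds + 4)"
    by (meson add_le_mono1 mult_le_mono2)
  moreover have "?a * total_size Ds \<le> ?a * ?s" by (intro mult_le_mono) auto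
  ultimately have "T_greedy B ds (j # js) Ds
      \<le> (?a * ?s + length ds + 3) + (length js * (?a * ?s + length ds + 4) + 1) + 1"
    using IH step unfolding T_greedy.simps by linarith
  then show ?case by (simp add: algebra_simps)
qed simp

text \<open>Every class is charged as if it had \<open>n\<close> deliveries. The summand
  \<open>2 * n\<close> pays for the append, and 3 collects the constants of the greedy run, the
  append and the call.\<close>

lemma T_greedy_classes_le:
  assumes "\<And>C. C \<in> set Cs \<Longrightarrow> length C \<le> n" "set (concat Cs) \<subseteq> deliveries ds"
  shows "T_greedy_classes B ds Cs
    \<le> length Cs * (n * (2 * (length ds + 2) * (2 * n) + length ds + 4) + 2 * n + 3) + 1"
  using assms
proof (induction Cs)
  case (Cons C Cs)
  let ?g = "n * (2 * (length ds + 2) * (2 * n) + length ds + 4)"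
  have n: "length C \<le> n" using Cons.prems by simp
  then have "length C * (2 * (length ds + 2) * (total_size [] + 2 * length C) + length ds + 4) \<le> ?g"
    by (intro mult_le_mono add_le_mono le_refl) auto
  then have "T_greedy B ds C [] \<le> ?g + 1"
    using T_greedy_le[of C ds "[]" B] Cons.prems(2) by simp
  moreover have "T_append (greedy B ds C []) (greedy_classes B ds Cs) \<le> 2 * n + 1"
    using length_le_total_size[of "greedy B ds C []"] total_size_greedy[of B ds C "[]"] n
    by (simp add: T_append)
  moreover have "T_greedy_classes B ds Cs \<le> length Cs * (?g + 2 * n + 3) + 1"
    using Cons by simp
  ultimately show ?case by simp
qed simp

lemma total_size_colour_classes: "total_size (colour_classes ds js Cs) \<le> total_size Cs + 2 * length js"
proof (induction js arbitrary: Cs)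
  case (Cons j js)
  show ?case using Cons[of "first_fit ds j Cs"] total_size_first_fit[of ds j Cs] by simp
qed simp

text \<open>One summand each for indexing, sorting, colouring and the greedy phase. The last one
  dominates with degree 4: at most \<open>2 * n\<close> classes at cubic cost each.\<close>

lemma T_apprx_algo_le:
  fixes ds :: "delivery list"
  defines "n \<equiv> length ds"
  shows "T_apprx_algo B ds \<le> (n + 1) + (n * ((2 * n + 3) * n + 2) + 1) +
    (n * ((4 * n + 5) * (2 * n) + 2) + 1) +
    (2 * n * (n * (2 * (n + 2) * (2 * n) + n + 4) + 2 * n + 3) + 1)"
proof -
  define js where "js = isort_left ds (index_from 0 ds)"
  define Cs where "Cs = colour_classes ds js []"
  have i: "length (index_from 0 ds) = n" by (simp add: index_from_eq n_def)
  have js: "length js = n" unfolding js_def using i by (metis mset_isort_left size_mset)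
  have set_js: "set js = deliveries ds"
    using mset_eq_setD[of js "[0..<length ds]"]
    by (simp add: js_def index_from_eq deliveries_def atLeast0LessThan)
  have mCs: "mset (concat Cs) = mset js"
    unfolding Cs_def mset_concat_colour_classes by simp
  then have len: "length (concat Cs) = n" using js by (metis size_mset)
  have dels: "set (concat Cs) \<subseteq> deliveries ds"
    using mset_eq_setD[OF mCs] set_js by simp
  have "length C \<le> n" if "C \<in> set Cs" for C
    using len member_le_sum_list[of "length C" "map length Cs"] that
    by (simp add: length_concat)
  then have "T_greedy_classes B ds Cs
    \<le> length Cs * (n * (2 * (n + 2) * (2 * n) + n + 4) + 2 * n + 3) + 1"
    using T_greedy_classes_le[of Cs n ds B] dels by (simp add: n_def)
  \<comment> \<open>Each delivery raises \<open>total_size\<close> by at most 2, hence the factor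
    2.\<close>
  moreover have "length Cs \<le> 2 * n"
    using total_size_colour_classes[of ds js "[]"] length_le_total_size[of Cs] js
    by (simp add: Cs_def)
  then have "length Cs * (n * (2 * (n + 2) * (2 * n) + n + 4) + 2 * n + 3)
    \<le> 2 * n * (n * (2 * (n + 2) * (2 * n) + n + 4) + 2 * n + 3)"
    by (rule mult_le_mono1)
  moreover have "T_isort_left ds (index_from 0 ds) \<le> n * ((2 * n + 3) * n + 2) + 1"
    using T_isort_left_le[of "index_from 0 ds" ds] i
    by (simp add: n_def index_from_eq deliveries_def atLeast0LessThan)
  moreover have "T_colour_classes ds js [] \<le> n * ((4 * n + 5) * (2 * n) + 2) + 1"
    using T_colour_classes_le[of js ds "[]"] js set_js by (simp add: n_def)
  moreover have "T_index_from 0 ds = n + 1" by (simp add: T_index_from_eq n_def)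
  ultimately show ?thesis
    unfolding T_apprx_algo.simps js_def[symmetric] Cs_def[symmetric] by linarith
qed

lemma T_apprx_algo_polynomial: "\<exists>p :: nat poly. \<forall>B ds. T_apprx_algo B ds \<le> poly p (length ds)"
proof -
  \<comment> \<open>With \<open>x\<close> the indeterminate, \<open>?p\<close> is the bound of
    \<open>T_apprx_algo_le\<close> read as a polynomial; evaluation commutes with sums and products
    and returns that bound.\<close>
  define x :: "nat poly" where "x = [:0, 1:]"
  have x: "poly x n = n" for n by (simp add: x_def)
  let ?p = "(x + 1) + (x * ((2 * x + 3) * x + 2) + 1) +
    (x * ((4 * x + 5) * (2 * x) + 2) + 1) +
    (2 * x * (x * (2 * (x + 2) * (2 * x) + x + 4) + 2 * x + 3) + 1)"
  have "T_apprx_algo B ds \<le> poly ?p (length ds)" for B ds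
    using T_apprx_algo_le[of B ds] by (simp only: poly_add poly_mult poly_1 poly_numeral x)
  then show ?thesis by blast
qed

text \<open>The guarantee ranges over all outputs that the relation admits. Running time belongs to
  a function, so the other conjuncts exhibit one whose output is admissible and whose step count is
  polynomial.\<close>

theorem theorem4p6:
  shows "(\<forall>B ds out. ddp_instance B ds \<longrightarrow> ApprxAlgoWithColouring B ds out \<longrightarrow>
            ddp_solution B ds out \<and> length out \<le> 2 * OPT B ds + clique_number ds) \<and>
         (\<forall>B ds. ddp_instance B ds \<longrightarrow> ApprxAlgoWithColouring B ds (apprx_algo B ds)) \<and>
         (\<exists>p :: nat poly. \<forall>B ds. ddp_instance B ds \<longrightarrow> T_apprx_algo B ds \<le> poly p (length ds))"
  using ApprxAlgoWithColouring_correct ApprxAlgoWithColouring_apprx_algo T_apprx_algo_polynomial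
  by blast

end
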